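(* Let $(V,\mathcal{E})$ be a finite $3$-uniform hypergraph with $|V|\ge 2$ in which no four vertices induce exactly two hyperedges, and let $\mathcal{L}$ be the set of (distinct) lines of this hypergraph. If $V\notin\mathcal{L}$, then $|\mathcal{L}|\ge |V|$, with equality if and only if $(V,\mathcal{E})$ generates a near-pencil, or generates a finite projective plane, or is the complement of a Steiner triple system.
   Context: A hypergraph is a pair $(V,\mathcal{E})$ with $\mathcal{E}$ a set of subsets of $V$; it is $3$-uniform if every hyperedge has exactly three elements. For distinct vertices $u,v$, the line $\overline{uv}$ is the set consisting of $u$, $v$, and all $w$ with $\{u,v,w\}\in\mathcal{E}$. For $W\subseteq V$, the sub-hypergraph induced by $W$ is $(W,\mathcal{F})$ where $\mathcal{F}$ consists of the hyperedges contained in $W$; "four vertices induce two hyperedges" means four distinct vertices whose induced sub-hypergraph has exactly two hyperedges. $\binom{S}{3}$ denotes the set of three-element subsets of $S$. $(V,\mathcal{E})$ generates a near-pencil if $\mathcal{E}=\binom{V\setminus\{w\}}{3}$ for some vertex $w$. A finite projective plane is a hypergraph $(V,\mathcal{L})$ such that for some integer $k\ge 2$, every two vertices lie in exactly one member of $\mathcal{L}$, $|V|=k(k-1)+1$, and every member of $\mathcal{L}$ has exactly $k$ elements; $(V,\mathcal{E})$ generates a finite projective plane if for some finite projective plane $(V,\mathcal{L})$ we have $\mathcal{E}=\bigcup_{L\in\mathcal{L}}\binom{L}{3}$. $(V,\mathcal{E})$ is the complement of a Steiner triple system if every two distinct vertices belong to exactly one member of $\binom{V}{3}\setminus\mathcal{E}$.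 *)

theory Defs
  imports Main "HOL-Library.Ramsey"
begin

definition hypergraph :: "'a set \<Rightarrow> 'a set set \<Rightarrow> bool" where
  "hypergraph V E \<longleftrightarrow> E \<subseteq> Pow V"

definition three_uniform :: "'a set set \<Rightarrow> bool" where
  "three_uniform E \<longleftrightarrow> (\<forall>e\<in>E. card e = 3)"

text \<open>Only meant for \<open>u \<noteq> v\<close>. In a 3-uniform hypergraph \<open>{u, v, w} \<in> E\<close> forces \<open>w\<close> to be
  a vertex different from \<open>u\<close> and \<open>v\<close>.\<close>

definition line :: "'a set set \<Rightarrow> 'a \<Rightarrow> 'a \<Rightarrow> 'a set" where
  "line E u v = {u, v} \<union> {w. {u, v, w} \<in> E}"

definition lines :: "'a set \<Rightarrow> 'a set set \<Rightarrow> 'a set set" where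
  "lines V E = {line E u v | u v. u \<in> V \<and> v \<in> V \<and> u \<noteq> v}"

definition induced_edges :: "'a set set \<Rightarrow> 'a set \<Rightarrow> 'a set set" where
  "induced_edges E W = {e \<in> E. e \<subseteq> W}"

definition four_vertices_induce_two :: "'a set \<Rightarrow> 'a set set \<Rightarrow> bool" where
  "four_vertices_induce_two V E \<longleftrightarrow>
     (\<exists>W\<subseteq>V. card W = 4 \<and> card (induced_edges E W) = 2)"

text \<open>Below, \<open>nsets S 3\<close> is the set of three-element subsets of \<open>S\<close>.\<close>

definition generates_near_pencil :: "'a set \<Rightarrow> 'a set set \<Rightarrow> bool" where
  "generates_near_pencil V E \<longleftrightarrow> (\<exists>w\<in>V. E = nsets (V - {w}) 3)"

definition finite_projective_plane :: "'a set \<Rightarrow> 'a set set \<Rightarrow> bool" where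
  "finite_projective_plane V L \<longleftrightarrow>
     hypergraph V L \<and> finite V \<and>
     (\<exists>k::nat. k \<ge> 2 \<and>
        (\<forall>u\<in>V. \<forall>v\<in>V. u \<noteq> v \<longrightarrow> (\<exists>!l. l \<in> L \<and> u \<in> l \<and> v \<in> l)) \<and>
        card V = k * (k - 1) + 1 \<and>
        (\<forall>l\<in>L. card l = k))"

definition generates_projective_plane :: "'a set \<Rightarrow> 'a set set \<Rightarrow> bool" where
  "generates_projective_plane V E \<longleftrightarrow>
     (\<exists>L. finite_projective_plane V L \<and> E = (\<Union>l\<in>L. nsets l 3))"

definition complement_of_steiner_triple_system :: "'a set \<Rightarrow> 'a set set \<Rightarrow> bool" where
  "complement_of_steiner_triple_system V E \<longleftrightarrow>
     (\<forall>u\<in>V. \<forall>v\<in>V. u \<noteq> v \<longrightarrow> (\<exists>!t. t \<in> nsets V 3 - E \<and> u \<in> t \<and> v \<in> t))"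

end

theory Submission
  imports Defs Complex_Main
begin

text \<open>The link graph of a vertex \<open>v\<close> (join \<open>a\<close> and \<open>b\<close> if \<open>{v, a, b}\<close> is a hyperedge) contains no
  induced path on four vertices, and each of its connected components, with \<open>v\<close> added, is closed
  under completing two vertices of a hyperedge to the whole hyperedge. Hence the closures of pairs
  form the blocks of a linear space. The hypothesis on four vertices is invariant under complementing
  the set of triples, and as a graph without induced 4-vertex paths or its complement is disconnected,
  the blocks are proper for the hypergraph or for its complement.

  In the first case every line spans a block and every block is spanned by a line, so the De
  Bruijn--Erdos theorem on linear spaces applies. In the second case the complement of a line is
  contained in a block, and by induction each block \<open>B\<close> contains at least \<open>|B|\<close> such complements;
  counting singleton complements separately gives the bound, with equality only if all complements are
  singletons.\<close>

section \<open>Linear spaces\<close>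

text \<open>\<open>block_psubset\<close> excludes the space whose only block is \<open>V\<close>,
  which has fewer blocks than points.\<close>

locale linear_space =
  fixes V :: "'a set" and L :: "'a set set"
  assumes finite_points: "finite V"
    and two_points: "2 \<le> card V"
    and block_psubset: "l \<in> L \<Longrightarrow> l \<subset> V"
    and block_card: "l \<in> L \<Longrightarrow> 2 \<le> card l"
    and unique_block: "\<lbrakk>u \<in> V; v \<in> V; u \<noteq> v\<rbrakk> \<Longrightarrow> \<exists>!l. l \<in> L \<and> u \<in> l \<and> v \<in> l"
begin

abbreviation deg :: "'a \<Rightarrow> nat" where
  "deg x \<equiv> card {l \<in> L. x \<in> l}"

section \<open>Joins, and blocks through a point compared with points on a block\<close>

definition join :: "'a \<Rightarrow> 'a \<Rightarrow> 'a set" where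
  "join u v = (THE l. l \<in> L \<and> u \<in> l \<and> v \<in> l)"

lemma finite_blocks: "finite L"
proof (rule finite_subset)
  show "L \<subseteq> Pow V" using block_psubset by blast
qed (simp add: finite_points)

lemma finite_block: "l \<in> L \<Longrightarrow> finite l"
  using block_psubset finite_points by (metis finite_subset psubset_imp_subset)

lemma block_eqI:
  assumes "l \<in> L" "m \<in> L" "u \<in> l" "v \<in> l" "u \<in> m" "v \<in> m" "u \<noteq> v"
  shows "l = m"
proof -
  have "u \<in> V" "v \<in> V" using assms block_psubset by blast+
  then show ?thesis using unique_block[of u v] assms by blast
qed

lemma join:
  assumes "u \<in> V" "v \<in> V" "u \<noteq> v"
  shows "join u v \<in> L" "u \<in> join u v" "v \<in> join u v"
  using theI'[OF unique_block[OF assms]] unfolding join_def by auto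

lemma inj_on_join:
  assumes "l \<in> L" "x \<in> V" "x \<notin> l"
  shows "inj_on (join x) l"
proof (rule inj_onI, rule ccontr)
  fix y z assume yz: "y \<in> l" "z \<in> l" "join x y = join x z" "y \<noteq> z"
  have "y \<in> V" "z \<in> V" "x \<noteq> y" "x \<noteq> z" using assms yz block_psubset by blast+
  with assms yz show False
    by (metis block_eqI join)
qed

lemma join_image_subset:
  assumes "l \<in> L" "x \<in> V" "x \<notin> l"
  shows "join x ` l \<subseteq> {m \<in> L. x \<in> m}"
proof
  fix m assume "m \<in> join x ` l"
  then obtain y where "y \<in> l" "m = join x y" by blast
  moreover from this have "y \<in> V" "x \<noteq> y" using assms block_psubset by blast+
  ultimately show "m \<in> {m \<in> L. x \<in> m}" using join assms by simp
qed

text \<open>Joining \<open>x\<close> to the points of \<open>l\<close> gives pairwise distinct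
  blocks: a repeated join would share two points with \<open>l\<close>, hence equal
  \<open>l\<close>, which misses \<open>x\<close>.\<close>

lemma card_le_deg:
  assumes "l \<in> L" "x \<in> V" "x \<notin> l"
  shows "card l \<le> deg x"
  using card_inj_on_le[OF inj_on_join[OF assms] join_image_subset[OF assms]] finite_blocks
  by simp

text \<open>When the counts agree, the joins of \<open>x\<close> with points of \<open>l\<close>
  exhaust the blocks through \<open>x\<close>.\<close>

lemma blocks_meet_if_card_eq_deg:
  assumes "l \<in> L" "x \<in> V" "x \<notin> l" "card l = deg x" "m \<in> L" "x \<in> m"
  shows "l \<inter> m \<noteq> {}"
proof -
  have "join x ` l = {m \<in> L. x \<in> m}"
    using assms(4) card_image[OF inj_on_join[OF assms(1-3)]] finite_blocks
    by (intro card_subset_eq join_image_subset assms(1-3)) simp_all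
  then obtain y where y: "y \<in> l" "m = join x y" using assms(5,6) by blast
  then have "y \<in> V" "x \<noteq> y" using assms(1,3) block_psubset by blast+
  then show ?thesis using y join assms(2) by blast
qed

text \<open>Take \<open>y\<close> different from \<open>x\<close> and \<open>z\<close> off the block
  through both; the block through \<open>y\<close> and \<open>z\<close> then misses
  \<open>x\<close>.\<close>

lemma ex_block_avoiding:
  assumes "x \<in> V"
  shows "\<exists>l\<in>L. x \<notin> l"
proof -
  have "\<not> V \<subseteq> {x}"
    using two_points card_mono[of "{x}" V] by auto
  then obtain y where y: "y \<in> V" "x \<noteq> y" by blast
  have "join x y \<subset> V" using block_psubset join[OF assms y] by blast
  then obtain z where z: "z \<in> V" "z \<notin> join x y" by blast
  then have "y \<noteq> z" using join[OF assms y] by blast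
  then have "x \<notin> join y z"
    using z y assms by (metis block_eqI join)
  then show ?thesis using join y z \<open>y \<noteq> z\<close> by blast
qed

lemma two_le_deg: "x \<in> V \<Longrightarrow> 2 \<le> deg x"
  using ex_block_avoiding block_card card_le_deg le_trans by meson

text \<open>Conway's argument: both sides of the termwise inequality sum to 1 over the
  non-incident pairs \<open>(x, l)\<close>.\<close>

lemma deg_eq_card_if_few_blocks:
  assumes le: "card L \<le> card V"
  shows "card L = card V" "\<And>x l. x \<in> V \<Longrightarrow> l \<in> L \<Longrightarrow> x \<notin> l \<Longrightarrow> deg x = card l"
proof -
  let ?v = "real (card V)" and ?b = "real (card L)"
  let ?A = "SIGMA x:V. {l \<in> L. x \<notin> l}"
  \<comment> \<open>Weights chosen so that \<open>f x\<close>, summed over the blocks missing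
    \<open>x\<close>, gives \<open>1 / ?v\<close>, while \<open>g l\<close>, summed over the points
    off \<open>l\<close>, gives \<open>1 / ?b\<close>.\<close>
  define f :: "'a \<Rightarrow> real" where "f x = 1 / (?v * (?b - real (deg x)))" for x
  define g :: "'a set \<Rightarrow> real" where "g l = 1 / (?b * (?v - real (card l)))" for l
  have finA: "finite ?A" using finite_points finite_blocks by simp
  have v0: "?v > 0" using two_points by simp
  have "V \<noteq> {}" using two_points by auto
  then have "L \<noteq> {}" using ex_block_avoiding by blast
  then have b0: "?b > 0" using finite_blocks by (simp add: card_gt_0_iff)
  have card_off: "real (card {l \<in> L. x \<notin> l}) = ?b - real (deg x)" for x
  proof -
    have "card L = deg x + card {l \<in> L. x \<notin> l}"
      using finite_blocks by (subst card_Un_disjoint[symmetric]) (auto intro: arg_cong[where f=card])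
    then show ?thesis by simp
  qed
  have deg_less: "real (deg x) < ?b" if "x \<in> V" for x
  proof -
    have "{l \<in> L. x \<in> l} \<subset> L" using ex_block_avoiding[OF that] by blast
    then show ?thesis using psubset_card_mono[OF finite_blocks] by simp
  qed
  have card_less: "real (card l) < ?v" if "l \<in> L" for l
    using psubset_card_mono[OF finite_points block_psubset[OF that]] by simp
  have card_pts_off: "real (card {x \<in> V. x \<notin> l}) = ?v - real (card l)" if "l \<in> L" for l
  proof -
    have "{x \<in> V. x \<notin> l} = V - l" by blast
    then show ?thesis
      using that block_psubset[OF that] finite_block[OF that] card_less[OF that]
      by (simp add: card_Diff_subset psubset_imp_subset of_nat_diff)
  qed
  have "(\<Sum>(x,l)\<in>?A. f x) = (\<Sum>x\<in>V. \<Sum>l\<in>{l \<in> L. x \<notin> l}. f x)"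
    using finite_points finite_blocks by (subst sum.Sigma) auto
  also have "\<dots> = (\<Sum>x\<in>V. 1 / ?v)"
    using deg_less v0 by (intro sum.cong) (auto simp: card_off f_def dest!: deg_less)
  also have "\<dots> = 1" using v0 by simp
  finally have sum_f: "(\<Sum>(x,l)\<in>?A. f x) = 1" .
  have "(\<Sum>(x,l)\<in>?A. g l) = (\<Sum>x\<in>V. \<Sum>l\<in>{l \<in> L. x \<notin> l}. g l)"
    using finite_points finite_blocks by (subst sum.Sigma) auto
  also have "\<dots> = (\<Sum>l\<in>L. \<Sum>x\<in>{x \<in> V. x \<notin> l}. g l)"
    using finite_points finite_blocks by (rule sum.swap_restrict)
  also have "\<dots> = (\<Sum>l\<in>L. 1 / ?b)"
    by (intro sum.cong) (auto simp: card_pts_off g_def dest!: card_less)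
  also have "\<dots> = 1" using b0 by simp
  finally have sum_g: "(\<Sum>(x,l)\<in>?A. g l) = 1" .
  \<comment> \<open>With denominators cleared, \<open>g l \<le> f x\<close> is exactly this
    inequality, the product of \<open>le\<close> and \<open>card_le_deg\<close>.\<close>
  have key: "?b * real (card l) \<le> ?v * real (deg x)" if "x \<in> V" "l \<in> L" "x \<notin> l" for x l
    using that le card_le_deg by (intro mult_mono) auto
  have gf: "g l \<le> f x" if "x \<in> V" "l \<in> L" "x \<notin> l" for x l
    unfolding f_def g_def
    using key[OF that] deg_less card_less that v0 b0
    by (intro divide_left_mono mult_pos_pos) (auto simp: algebra_simps)
  \<comment> \<open>Both sums equal 1, so none of the termwise inequalities is strict.\<close>
  have "\<forall>p\<in>?A. (case p of (x,l) \<Rightarrow> g l) = (case p of (x,l) \<Rightarrow> f x)"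
    using sum_mono_inv[of "\<lambda>(x,l). g l" ?A "\<lambda>(x,l). f x"] sum_f sum_g gf finA by fastforce
  then have "g l = f x" if "x \<in> V" "l \<in> L" "x \<notin> l" for x l using that by auto
  then have eq: "?b * real (card l) = ?v * real (deg x)" if "x \<in> V" "l \<in> L" "x \<notin> l" for x l
    using that deg_less[of x] card_less[of l] v0 b0
    unfolding f_def g_def by (simp add: algebra_simps)
  \<comment> \<open>Fewer blocks than points would make the product inequality strict.\<close>
  have less: False if "card L < card V" "x \<in> V" "l \<in> L" "x \<notin> l" for x l
  proof -
    have "?b * real (card l) < ?v * real (deg x)"
      using that card_le_deg[of l x] block_card[of l] by (intro mult_less_le_imp_less) auto
    then show False using eq that by simp
  qed
  obtain x l where "x \<in> V" "l \<in> L" "x \<notin> l" using ex_block_avoiding \<open>V \<noteq> {}\<close> by blast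
  then show bv: "card L = card V" using less le by (meson le_neq_implies_less)
  show "deg x = card l" if "x \<in> V" "l \<in> L" "x \<notin> l" for x l
    using eq[OF that] v0 unfolding bv by simp
qed

lemma card_points_le_blocks: "card V \<le> card L"
  using deg_eq_card_if_few_blocks(1) by linarith

text \<open>The blocks through \<open>x\<close>, with \<open>x\<close> removed, partition the
  remaining points.\<close>

lemma sum_card_blocks: "x \<in> V \<Longrightarrow> (\<Sum>l\<in>{l \<in> L. x \<in> l}. card (l - {x})) = card V - 1"
proof -
  assume x: "x \<in> V"
  have "V - {x} = (\<Union>l\<in>{l \<in> L. x \<in> l}. l - {x})"
  proof (intro equalityI subsetI)
    fix y assume "y \<in> V - {x}"
    then show "y \<in> (\<Union>l\<in>{l \<in> L. x \<in> l}. l - {x})"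
      using join[of x y] x by (intro UN_I[of "join x y"]) auto
  qed (use block_psubset in blast)
  moreover have "card (\<Union>l\<in>{l \<in> L. x \<in> l}. l - {x}) = (\<Sum>l\<in>{l \<in> L. x \<in> l}. card (l - {x}))"
  proof (rule card_UN_disjoint)
    show "\<forall>l\<in>{l \<in> L. x \<in> l}. \<forall>m\<in>{l \<in> L. x \<in> l}. l \<noteq> m \<longrightarrow> (l - {x}) \<inter> (m - {x}) = {}"
      using block_eqI by blast
  qed (use finite_blocks finite_block in auto)
  ultimately show ?thesis using x finite_points by (metis card_Diff_singleton)
qed

text \<open>Equality gives \<open>deg x = card l\<close> for all non-incident pairs, so any two
  blocks meet. If two blocks cover \<open>V\<close>, one of them has only two points and the other
  misses a single point. Otherwise any two blocks miss a common point, so all blocks have the same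
  size \<open>k\<close>, and counting along the \<open>k\<close> blocks through one point gives the
  number of points.\<close>

lemma near_pencil_or_projective_plane:
  assumes eq: "card L = card V"
  shows "(\<exists>w\<in>V. V - {w} \<in> L \<and> (\<forall>l\<in>L. w \<in> l \<longrightarrow> card l = 2)) \<or> finite_projective_plane V L"
proof -
  have deg: "deg x = card l" if "x \<in> V" "l \<in> L" "x \<notin> l" for x l
    using deg_eq_card_if_few_blocks(2) eq that by simp
  have meet: "l \<inter> m \<noteq> {}" if "l \<in> L" "m \<in> L" for l m
  proof (cases "m \<subseteq> l")
    case True
    moreover have "m \<noteq> {}" using block_card[OF that(2)] by auto
    ultimately show ?thesis by blast
  next
    case False
    then obtain x where x: "x \<in> m" "x \<notin> l" by blast
    then have "x \<in> V" using that block_psubset by blast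
    then show ?thesis
      using blocks_meet_if_card_eq_deg[of l x m] deg[of x l] x that by simp
  qed
  show ?thesis
  proof (cases "\<exists>l\<in>L. \<exists>m\<in>L. l \<union> m = V")
    case True
    then obtain l m where lm: "l \<in> L" "m \<in> L" "l \<union> m = V" by blast
    obtain p where p: "p \<in> l" "p \<in> m" using meet lm by blast
    have "l \<noteq> m" using lm block_psubset by blast
    then have p_only: "q = p" if "q \<in> l" "q \<in> m" for q
      using block_eqI[OF lm(1,2)] p that by blast
    \<comment> \<open>Stated for arbitrary \<open>l\<close> and \<open>m\<close> because it is
      applied to the two covering blocks in either order.\<close>
    have pencil: ?thesis if lm: "l \<in> L" "m \<in> L" "l \<union> m = V" "p \<in> l" "p \<in> m" "m - {p} = {w}"
      and p_only: "\<And>q. q \<in> l \<Longrightarrow> q \<in> m \<Longrightarrow> q = p" for l m w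
    proof -
      have "w \<in> V" "V - {w} = l" "w \<notin> l" using lm p_only by blast+
      moreover have "card k = 2" if k: "k \<in> L" "w \<in> k" for k
      proof -
        obtain q where q: "q \<in> k" "q \<in> l" using meet k lm by blast
        have "k \<noteq> l" using \<open>w \<notin> l\<close> k by blast
        then have "k \<inter> l = {q}" using block_eqI[OF k(1) lm(1)] q by blast
        moreover have "k \<subseteq> V" using k block_psubset by blast
        ultimately have "k = {q, w}" using \<open>V - {w} = l\<close> k by blast
        then show ?thesis using block_card[OF k(1)] by (cases "q = w") auto
      qed
      ultimately show ?thesis using lm by blast
    qed
    have nontrivial: "k - {p} \<noteq> {}" if "k \<in> L" for k
    proof
      assume "k - {p} = {}"
      then have "card k \<le> card {p}" by (intro card_mono) auto
      then show False using block_card[OF that] by simp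
    qed
    show ?thesis
    proof (rule ccontr)
      assume np: "\<not> ?thesis"
      obtain a b where ab: "a \<in> l - {p}" "b \<in> m - {p}" using nontrivial lm by blast
      have mb: "m - {p} \<noteq> {b}"
        using np pencil[OF lm p _ p_only] by blast
      have la: "l - {p} \<noteq> {a}"
        using np pencil[OF lm(2,1) _ p(2,1) _ p_only] lm(3) by (metis Un_commute)
      \<comment> \<open>With two points besides \<open>p\<close> on each side, \<open>{a, b}\<close>
        and \<open>{a', b'}\<close> would be disjoint blocks: as \<open>l\<close> and
        \<open>m\<close> cover \<open>V\<close>, a join across them contains no third point.\<close>
      obtain a' where a': "a' \<in> l - {p}" "a' \<noteq> a" using la ab by blast
      obtain b' where b': "b' \<in> m - {p}" "b' \<noteq> b" using mb ab by blast
      have short: "join a b \<subseteq> {a, b} \<and> join a b \<in> L" if ab: "a \<in> l - {p}" "b \<in> m - {p}" for a b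
      proof -
        have d: "a \<in> V" "b \<in> V" "a \<noteq> b" "a \<notin> m" "b \<notin> l" using ab lm p_only by blast+
        note j = join[OF d(1-3)]
        have "c = a" if "c \<in> join a b" "c \<in> l" for c
          using block_eqI[OF j(1) lm(1)] j that d ab by blast
        moreover have "c = b" if "c \<in> join a b" "c \<in> m" for c
          using block_eqI[OF j(1) lm(2)] j that d ab by blast
        ultimately show ?thesis using j block_psubset lm(3) by blast
      qed
      have "join a b \<inter> join a' b' \<noteq> {}" using meet short ab a' b' by simp
      then have "{a, b} \<inter> {a', b'} \<noteq> {}" using short[of a b] short[of a' b'] ab a' b' by blast
      then show False using ab a' b' p_only by blast
    qed
  next
    case False
    have same: "card l = card m" if "l \<in> L" "m \<in> L" for l m
    proof -
      have "l \<union> m \<subset> V" using False that block_psubset[of l] block_psubset[of m] by blast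
      then obtain x where "x \<in> V" "x \<notin> l" "x \<notin> m" by blast
      then show ?thesis using deg[of x l] deg[of x m] that by simp
    qed
    have "V \<noteq> {}" using two_points by auto
    then obtain x l where xl: "x \<in> V" "l \<in> L" "x \<notin> l" using ex_block_avoiding by blast
    define k where "k = card l"
    have "card (m - {x}) = k - 1" if "m \<in> L" "x \<in> m" for m
      using that same[OF xl(2)] finite_block by (simp add: k_def)
    then have "card V - 1 = (\<Sum>m\<in>{m \<in> L. x \<in> m}. k - 1)"
      using sum_card_blocks[OF xl(1)] by simp
    also have "\<dots> = k * (k - 1)" using deg[OF xl] by (simp add: k_def)
    finally have "card V = k * (k - 1) + 1" using two_points by simp
    moreover have "hypergraph V L" using block_psubset unfolding hypergraph_def by blast
    moreover have "2 \<le> k" using block_card xl k_def by simp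
    moreover have "\<forall>m\<in>L. card m = k" using same xl k_def by blast
    ultimately have "finite_projective_plane V L"
      unfolding finite_projective_plane_def using finite_points unique_block by blast
    then show ?thesis ..
  qed
qed

end

section \<open>Splitting graphs without induced paths on four vertices\<close>

text \<open>For symmetric \<open>g\<close> these graphs are known as cographs; the three
  alternatives are the possible chords of the path.\<close>

definition P4_free :: "('a \<Rightarrow> 'a \<Rightarrow> bool) \<Rightarrow> 'a set \<Rightarrow> bool" where
  "P4_free g S \<longleftrightarrow> (\<forall>a\<in>S. \<forall>b\<in>S. \<forall>c\<in>S. \<forall>d\<in>S. distinct [a, b, c, d] \<longrightarrow>
     g a b \<longrightarrow> g b c \<longrightarrow> g c d \<longrightarrow> g a c \<or> g b d \<or> g a d)"

text \<open>Disconnectedness of the graph \<open>g\<close> on \<open>S\<close>, expressed by a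
  partition without crossing edges.\<close>

definition splits :: "('a \<Rightarrow> 'a \<Rightarrow> bool) \<Rightarrow> 'a set \<Rightarrow> bool" where
  "splits g S \<longleftrightarrow> (\<exists>A B. A \<noteq> {} \<and> B \<noteq> {} \<and> A \<inter> B = {} \<and> A \<union> B = S \<and>
     (\<forall>a\<in>A. \<forall>b\<in>B. \<not> g a b))"

lemma P4_freeD:
  assumes "P4_free g S" "a \<in> S" "b \<in> S" "c \<in> S" "d \<in> S" "distinct [a, b, c, d]"
    and "g a b" "g b c" "g c d"
  shows "g a c \<or> g b d \<or> g a d"
  by (rule assms(1)[unfolded P4_free_def, rule_format, OF assms(2-)])

lemma splitsI:
  assumes "A \<noteq> {}" "B \<noteq> {}" "A \<inter> B = {}" "A \<union> B = S" "\<And>a b. a \<in> A \<Longrightarrow> b \<in> B \<Longrightarrow> \<not> g a b"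
  shows "splits g S"
  unfolding splits_def using assms by (intro exI[of _ A] exI[of _ B]) simp

lemma splitsE:
  assumes "splits g S"
  obtains A B where "A \<noteq> {}" "B \<noteq> {}" "A \<inter> B = {}" "A \<union> B = S"
    "\<And>a b. a \<in> A \<Longrightarrow> b \<in> B \<Longrightarrow> \<not> g a b"
  using assms unfolding splits_def by blast

lemma P4_free_subset: "P4_free g S \<Longrightarrow> T \<subseteq> S \<Longrightarrow> P4_free g T"
  unfolding P4_free_def by blast

text \<open>The path on four vertices is self-complementary: an induced path
  \<open>a, b, c, d\<close> in the complement gives the induced path \<open>c, a, d, b\<close> in
  \<open>g\<close>.\<close>

lemma P4_free_complement:
  assumes "P4_free g S" and sym: "symp g"
  shows "P4_free (\<lambda>a b. \<not> g a b) S"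
  unfolding P4_free_def
proof (intro ballI impI, rule ccontr)
  fix a b c d
  assume in_S: "a \<in> S" "b \<in> S" "c \<in> S" "d \<in> S" and dist: "distinct [a, b, c, d]"
    and non: "\<not> g a b" "\<not> g b c" "\<not> g c d"
    and "\<not> (\<not> g a c \<or> \<not> g b d \<or> \<not> g a d)"
  then have "g c a" "g a d" "g d b" using sym by (auto dest: sympD)
  then have "g c d \<or> g a b \<or> g c b"
    using P4_freeD[OF assms(1), of c a d b] in_S dist by auto
  then show False using non sym by (auto dest: sympD)
qed

text \<open>Let \<open>N\<close> and \<open>T\<close> be the neighbours and non-neighbours of
  \<open>x\<close> in \<open>S\<close>. If one of them is empty, \<open>{x}\<close> splits off in
  \<open>g\<close> or in its complement. If no edge joins them, \<open>T\<close> splits off.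
  Otherwise some edge leads from \<open>y\<close> in \<open>T\<close> to \<open>N\<close>, and the
  side of the old partition without \<open>y\<close> stays separated after adding
  \<open>x\<close>.\<close>

lemma splits_insert:
  assumes "splits g S" "x \<notin> S" "P4_free g (insert x S)" and sym: "symp g"
  shows "splits g (insert x S) \<or> splits (\<lambda>a b. \<not> g a b) (insert x S)"
proof -
  obtain A B where AB: "A \<noteq> {}" "B \<noteq> {}" "A \<inter> B = {}" "A \<union> B = S"
    "\<And>a b. a \<in> A \<Longrightarrow> b \<in> B \<Longrightarrow> \<not> g a b"
    by (rule splitsE[OF assms(1)]) (rule that)
  have g_sym: "g a b \<longleftrightarrow> g b a" for a b using sym by (auto dest: sympD)
  define N where "N = {y \<in> S. g x y}"
  define T where "T = S - N"
  consider "N = {}" | "T = {}" | "N \<noteq> {}" "T \<noteq> {}" "\<forall>y\<in>T. \<forall>z\<in>N. \<not> g y z"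
    | y z where "y \<in> T" "z \<in> N" "g y z" by blast
  then show ?thesis
  proof cases
    case 1
    then have "splits g (insert x S)"
      using AB assms(2) by (intro splitsI[of "{x}" S]) (auto simp: N_def)
    then show ?thesis ..
  next
    case 2
    then have "splits (\<lambda>a b. \<not> g a b) (insert x S)"
      using AB assms(2) by (intro splitsI[of "{x}" S]) (auto simp: N_def T_def)
    then show ?thesis ..
  next
    case 3
    have "splits g (insert x S)"
    proof (rule splitsI[of T "insert x N"])
      show "\<not> g a b" if "a \<in> T" "b \<in> insert x N" for a b
      proof (cases "b = x")
        case True
        then show ?thesis using that(1) g_sym[of a x] by (simp add: N_def T_def)
      next
        case False
        then show ?thesis using that 3(3) by simp
      qed
    qed (use 3(2) assms(2) in \<open>auto simp: N_def T_def\<close>)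
    then show ?thesis ..
  next
    case 4
    text \<open>A neighbour of \<open>x\<close> on the far side would start an induced path through \<open>x, z, y\<close>.\<close>
    have far: "\<not> g x w"
      if PQ: "P \<union> Q = S" "P \<inter> Q = {}" "\<And>a b. a \<in> P \<Longrightarrow> b \<in> Q \<Longrightarrow> \<not> g a b"
        and "y \<in> P" "w \<in> Q" for P Q w
    proof
      assume "g x w"
      have "z \<in> P" using PQ(1) PQ(3)[of y z] \<open>y \<in> P\<close> 4 by (auto simp: N_def)
      have "distinct [w, x, z, y]"
        using \<open>z \<in> P\<close> PQ(1,2) \<open>y \<in> P\<close> \<open>w \<in> Q\<close> \<open>g x w\<close> 4 assms(2)
        by (auto simp: N_def T_def)
      moreover have "g w x" "g x z" "g z y" using \<open>g x w\<close> 4 g_sym[of w x] g_sym[of z y] by (auto simp: N_def)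
      ultimately have "g w z \<or> g x y \<or> g w y"
        using P4_freeD[OF assms(3), of w x z y] PQ(1) \<open>y \<in> P\<close> \<open>w \<in> Q\<close> \<open>z \<in> P\<close> by auto
      then show False
        using 4(1) PQ(3)[OF \<open>z \<in> P\<close> \<open>w \<in> Q\<close>] PQ(3)[OF \<open>y \<in> P\<close> \<open>w \<in> Q\<close>] PQ(1) \<open>y \<in> P\<close>
          g_sym[of w z] g_sym[of w y]
        by (auto simp: N_def T_def)
    qed
    have split: "splits g (insert x S)"
      if PQ: "P \<union> Q = S" "P \<inter> Q = {}" "\<And>a b. a \<in> P \<Longrightarrow> b \<in> Q \<Longrightarrow> \<not> g a b"
        and "y \<in> P" "Q \<noteq> {}" for P Q
    proof (rule splitsI[of "insert x P" Q])
      show "\<not> g a b" if "a \<in> insert x P" "b \<in> Q" for a b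
        using far[OF PQ \<open>y \<in> P\<close> that(2)] PQ(3)[of a b] that by auto
    qed (use PQ(1,2) \<open>y \<in> P\<close> \<open>Q \<noteq> {}\<close> assms(2) in auto)
    have "y \<in> A \<or> y \<in> B" using 4 AB by (auto simp: T_def)
    then have "splits g (insert x S)"
    proof
      assume "y \<in> A"
      then show ?thesis using split[of A B] AB by blast
    next
      assume "y \<in> B"
      then show ?thesis using split[of B A] AB g_sym by blast
    qed
    then show ?thesis ..
  qed
qed

text \<open>Seinsche's theorem, by adding one vertex at a time: \<open>splits_insert\<close> is
  applied to \<open>g\<close> or to its complement, whichever the induction hypothesis
  splits.\<close>

lemma P4_free_splits:
  assumes "finite S" "2 \<le> card S" "P4_free g S" "symp g"
  shows "splits g S \<or> splits (\<lambda>a b. \<not> g a b) S"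
  using assms(1-3)
proof (induction S rule: finite_induct)
  case (insert x S)
  have free: "P4_free g S" using insert.prems(2) by (rule P4_free_subset) blast
  show ?case
  proof (cases "2 \<le> card S")
    case True
    then consider "splits g S" | "splits (\<lambda>a b. \<not> g a b) S" using insert.IH free by blast
    then show ?thesis
    proof cases
      case 1
      from splits_insert[OF this insert.hyps(2) insert.prems(2) assms(4)] show ?thesis .
    next
      case 2
      have "symp (\<lambda>a b. \<not> g a b)" using assms(4) by (auto simp: symp_def)
      from splits_insert[OF 2 insert.hyps(2) P4_free_complement[OF insert.prems(2) assms(4)] this]
      show ?thesis by auto
    qed
  next
    case False
    then have "card S = 1" using insert by simp
    then obtain y where "S = {y}" by (rule card_1_singletonE)
    then show ?thesis
      using insert.hyps splitsI[of "{x}" "{y}" "insert x S" g]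
        splitsI[of "{x}" "{y}" "insert x S" "\<lambda>a b. \<not> g a b"] by auto
  qed
qed simp

section \<open>Edge-closed sets\<close>

lemma triple_in_nsets_iff:
  "{a, b, c} \<in> nsets V 3 \<longleftrightarrow> a \<in> V \<and> b \<in> V \<and> c \<in> V \<and> a \<noteq> b \<and> a \<noteq> c \<and> b \<noteq> c"
  by (auto simp: nsets_def card_insert_if)

definition edge_closed :: "'a set set \<Rightarrow> 'a set \<Rightarrow> bool" where
  "edge_closed E X \<longleftrightarrow> (\<forall>a\<in>X. \<forall>b\<in>X. \<forall>c. {a, b, c} \<in> E \<longrightarrow> c \<in> X)"

text \<open>The set \<open>V\<close> itself may be a block; the linear space arises when it is
  not.\<close>

definition blocks :: "'a set \<Rightarrow> 'a set set \<Rightarrow> 'a set set" where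
  "blocks V E = {edge_closed E hull {u, v} | u v. u \<in> V \<and> v \<in> V \<and> u \<noteq> v}"

text \<open>A relation rather than a predicate, so that components are images under the reflexive
  transitive closure.\<close>

definition link :: "'a set set \<Rightarrow> 'a \<Rightarrow> 'a rel" where
  "link E v = {(a, b). {v, a, b} \<in> E}"

lemma edge_closedD: "edge_closed E X \<Longrightarrow> {a, b, c} \<in> E \<Longrightarrow> a \<in> X \<Longrightarrow> b \<in> X \<Longrightarrow> c \<in> X"
  unfolding edge_closed_def by blast

lemma edge_closed_hull: "edge_closed E (edge_closed E hull S)"
proof (rule hull_in)
  fix T assume closed: "\<forall>X\<in>T. edge_closed E X"
  show "edge_closed E (\<Inter>T)"
    unfolding edge_closed_def
  proof (intro ballI allI impI InterI)
    fix a b c X assume "a \<in> \<Inter>T" "b \<in> \<Inter>T" "{a, b, c} \<in> E" "X \<in> T"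
    then show "c \<in> X" using closed edge_closedD[of E X a b c] by simp
  qed
qed

lemma line_subset_hull: "line E u v \<subseteq> edge_closed E hull {u, v}"
proof -
  have "u \<in> edge_closed E hull {u, v}" "v \<in> edge_closed E hull {u, v}"
    by (simp_all add: hull_inc)
  then show ?thesis
    using edge_closedD[OF edge_closed_hull] by (auto simp: line_def)
qed

text \<open>Thus a line determines the block of any pair spanning it, and taking hulls maps lines to
  blocks.\<close>

lemma hull_line: "edge_closed E hull line E u v = edge_closed E hull {u, v}"
proof
  show "edge_closed E hull line E u v \<subseteq> edge_closed E hull {u, v}"
    by (intro hull_minimal line_subset_hull edge_closed_hull)
  show "edge_closed E hull {u, v} \<subseteq> edge_closed E hull line E u v"
    by (intro hull_mono) (auto simp: line_def)
qed

lemma sym_link: "sym (link E v)"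
  unfolding link_def by (auto intro!: symI simp: insert_commute)

lemma sym_link_rtrancl: "(a, b) \<in> (link E v)\<^sup>* \<Longrightarrow> (b, a) \<in> (link E v)\<^sup>*"
  using sym_rtrancl[OF sym_link] by (rule symD)

text \<open>Two hyperedges on four vertices share two vertices \<open>a\<close> and
  \<open>b\<close>, so excluding exactly two hyperedges amounts to the existence of a third one,
  which contains both \<open>c\<close> and \<open>d\<close>.\<close>

locale no_two_of_four =
  fixes V :: "'a set" and E :: "'a set set"
  assumes finite_vertices: "finite V"
    and edges: "E \<subseteq> nsets V 3"
    and third_edge: "\<lbrakk>{a, b, c} \<in> E; {a, b, d} \<in> E; c \<noteq> d\<rbrakk> \<Longrightarrow> {a, c, d} \<in> E \<or> {b, c, d} \<in> E"
begin

lemma edgeD: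
  assumes "{a, b, c} \<in> E"
  shows "a \<in> V" "b \<in> V" "c \<in> V" "a \<noteq> b" "a \<noteq> c" "b \<noteq> c"
  using assms edges triple_in_nsets_iff[of a b c V] by blast+

text \<open>Four vertices carry four triples, so exactly two are hyperedges iff exactly two are
  not.\<close>

lemma complement: "no_two_of_four V (nsets V 3 - E)"
proof
  fix a b c d
  assume N: "{a, b, c} \<in> nsets V 3 - E" "{a, b, d} \<in> nsets V 3 - E" "c \<noteq> d"
  show "{a, c, d} \<in> nsets V 3 - E \<or> {b, c, d} \<in> nsets V 3 - E"
  proof (rule ccontr)
    assume "\<not> ?thesis"
    then have "{c, d, a} \<in> E" "{c, d, b} \<in> E" "a \<noteq> b"
      using N by (auto simp: triple_in_nsets_iff insert_commute)
    from third_edge[OF this] show False using N by (auto simp: insert_commute)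
  qed
qed (simp_all add: finite_vertices)

lemma restrict: "B \<subseteq> V \<Longrightarrow> no_two_of_four B (E \<inter> nsets B 3)"
proof
  fix a b c d
  assume abcd: "{a, b, c} \<in> E \<inter> nsets B 3" "{a, b, d} \<in> E \<inter> nsets B 3" "c \<noteq> d"
  then show "{a, c, d} \<in> E \<inter> nsets B 3 \<or> {b, c, d} \<in> E \<inter> nsets B 3"
    using third_edge[of a b c d] by (auto simp: triple_in_nsets_iff)
qed (auto intro: finite_subset finite_vertices)

text \<open>For an induced path \<open>a, b, c, d\<close> in the link of \<open>v\<close>,
  \<open>third_edge\<close> forces \<open>{a, b, c}\<close> and \<open>{b, c, d}\<close>, hence
  \<open>{a, b, d}\<close> or \<open>{a, c, d}\<close>. Either way, that triple and \<open>v\<close>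
  form four vertices with exactly two hyperedges.\<close>

lemma link_P4_free:
  assumes "{v, a, b} \<in> E" "{v, b, c} \<in> E" "{v, c, d} \<in> E"
  shows "{v, a, c} \<in> E \<or> {v, b, d} \<in> E \<or> {v, a, d} \<in> E"
proof (rule ccontr)
  assume non: "\<not> ?thesis"
  then have "a \<noteq> c" "b \<noteq> d" "a \<noteq> d" using assms by (auto simp: insert_commute)
  have "{a, b, c} \<in> E"
    using third_edge[of v b a c] assms non \<open>a \<noteq> c\<close> by (auto simp: insert_commute)
  moreover have "{b, c, d} \<in> E"
    using third_edge[of v c b d] assms non \<open>b \<noteq> d\<close> by (auto simp: insert_commute)
  ultimately have "{a, b, d} \<in> E \<or> {a, c, d} \<in> E"
    using third_edge[of b c a d] \<open>a \<noteq> d\<close> by (auto simp: insert_commute)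
  then show False
  proof
    assume "{a, b, d} \<in> E"
    then show False
      using third_edge[of a b d v] assms non edgeD[OF assms(3)] by (auto simp: insert_commute)
  next
    assume "{a, c, d} \<in> E"
    then show False
      using third_edge[of c d a v] assms non edgeD[OF assms(1)] by (auto simp: insert_commute)
  qed
qed

text \<open>Components of the link have diameter at most 2, since a longer walk can be shortened by
  a chord.\<close>

lemma link_rtrancl_cases:
  assumes "(a, b) \<in> (link E v)\<^sup>*"
  shows "a = b \<or> {v, a, b} \<in> E \<or> (\<exists>d. {v, a, d} \<in> E \<and> {v, d, b} \<in> E)"
  using assms
proof (induction rule: rtrancl_induct)
  case (step b c)
  have bc: "{v, b, c} \<in> E" using step.hyps by (simp add: link_def)
  from step.IH consider "a = b" | "{v, a, b} \<in> E" | d where "{v, a, d} \<in> E" "{v, d, b} \<in> E"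
    by blast
  then show ?case
  proof cases
    case 3
    then show ?thesis using link_P4_free[of v a d b c] bc by blast
  qed (use bc in blast)+
qed simp

text \<open>If \<open>a\<close> and \<open>b\<close> are adjacent in the link,
  \<open>third_edge\<close> makes \<open>c\<close> adjacent to one of them. If not, they have a
  common neighbour \<open>d\<close>; then \<open>{a, b, d}\<close> is a hyperedge, and together with
  \<open>{a, b, c}\<close> it yields \<open>{a, d, c}\<close> or \<open>{b, d, c}\<close>, which
  reduces to the adjacent case.\<close>

lemma edge_closed_component: "edge_closed E (insert v ((link E v)\<^sup>* `` {u}))" (is "edge_closed E (insert v ?K)")
  unfolding edge_closed_def
proof (intro ballI allI impI)
  fix a b c
  assume ab: "a \<in> insert v ?K" "b \<in> insert v ?K" and abc: "{a, b, c} \<in> E"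
  have K: "y \<in> ?K" if "x \<in> ?K" "{v, x, y} \<in> E" for x y
    using that by (auto simp: link_def intro: rtrancl_into_rtrancl)
  have adjacent: "c \<in> ?K" if "a \<in> ?K" "b \<in> ?K" "{v, a, b} \<in> E" "{a, b, c} \<in> E" "c \<noteq> v" for a b c
  proof -
    have "{a, c, v} \<in> E \<or> {b, c, v} \<in> E"
      using third_edge[of a b c v] that by (simp add: insert_commute)
    then show ?thesis using K[of a c] K[of b c] that by (auto simp: insert_commute)
  qed
  consider "a = v" "b \<in> ?K" | "b = v" "a \<in> ?K" | "c = v" | "a \<in> ?K" "b \<in> ?K" "c \<noteq> v"
    using ab edgeD[OF abc] by blast
  then show "c \<in> insert v ?K"
  proof cases
    case 4
    then have "(a, b) \<in> (link E v)\<^sup>*"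
      using sym_link_rtrancl[of u a] by (auto intro: rtrancl_trans)
    then consider "{v, a, b} \<in> E" | d where "{v, a, b} \<notin> E" "{v, a, d} \<in> E" "{v, d, b} \<in> E"
      using link_rtrancl_cases edgeD[OF abc] by blast
    then show ?thesis
    proof cases
      case 1
      then show ?thesis using adjacent 4 abc by blast
    next
      case 2
      have d: "d \<in> ?K" using K[of a d] 2 4 by blast
      have "{a, b, d} \<in> E"
        using third_edge[of v d a b] 2 edgeD[OF abc] by (auto simp: insert_commute)
      show ?thesis
      proof (cases "c = d")
        case False
        then have "{a, d, c} \<in> E \<or> {b, d, c} \<in> E"
          using third_edge[of a b d c] \<open>{a, b, d} \<in> E\<close> abc by blast
        then show ?thesis
          using adjacent[of a d c] adjacent[of b d c] 2 4 d by (auto simp: insert_commute)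
      qed (use d in simp)
    qed
  qed (use abc K[of b c] K[of a c] in \<open>auto simp: insert_commute\<close>)
qed

lemma hull_pair: "edge_closed E hull {v, u} = insert v ((link E v)\<^sup>* `` {u})"
proof
  show "edge_closed E hull {v, u} \<subseteq> insert v ((link E v)\<^sup>* `` {u})"
    by (rule hull_minimal) (use edge_closed_component in auto)
  let ?H = "edge_closed E hull {v, u}"
  have "v \<in> ?H" "u \<in> ?H" by (auto intro: hull_inc)
  moreover have "w \<in> ?H" if "(u, w) \<in> (link E v)\<^sup>*" for w
    using that
  proof (induction rule: rtrancl_induct)
    case (step y z)
    then show ?case
      using edge_closedD[OF edge_closed_hull, of v y z] \<open>v \<in> ?H\<close> by (auto simp: link_def)
  qed (use \<open>u \<in> ?H\<close> in simp)
  ultimately show "insert v ((link E v)\<^sup>* `` {u}) \<subseteq> ?H" by blast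
qed

lemma hull_exchange:
  assumes "w \<in> edge_closed E hull {v, u}" "w \<noteq> v"
  shows "edge_closed E hull {v, w} = edge_closed E hull {v, u}"
proof -
  have "(u, w) \<in> (link E v)\<^sup>*" using assms by (simp add: hull_pair)
  then show ?thesis
    unfolding hull_pair using sym_link_rtrancl[of u w] by (auto intro: rtrancl_trans)
qed

text \<open>Exchange one generator at a time, as for bases of a matroid. This makes the block
  through two vertices unique.\<close>

lemma hull_pair_eqI:
  assumes "a \<in> edge_closed E hull {u, v}" "b \<in> edge_closed E hull {u, v}" "a \<noteq> b"
  shows "edge_closed E hull {a, b} = edge_closed E hull {u, v}"
proof (cases "a = u")
  case True
  then show ?thesis using assms hull_exchange by metis
next
  case False
  then have "edge_closed E hull {a, u} = edge_closed E hull {u, v}"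
    using hull_exchange[OF assms(1)] by (simp add: insert_commute)
  then show ?thesis using hull_exchange[of b a u] assms by simp
qed

section \<open>Hulls of vertex pairs as blocks of a linear space\<close>

lemma hull_subset_vertices: "u \<in> V \<Longrightarrow> v \<in> V \<Longrightarrow> edge_closed E hull {u, v} \<subseteq> V"
  by (rule hull_minimal) (auto simp: edge_closed_def dest: edgeD)

lemma hull_pair_refl:
  "u \<in> edge_closed E hull {u, v}" "v \<in> edge_closed E hull {u, v}"
  by (auto intro: hull_inc)

lemma blocks_eqI:
  assumes "B \<in> blocks V E" "a \<in> B" "b \<in> B" "a \<noteq> b"
  shows "B = edge_closed E hull {a, b}"
  using assms hull_pair_eqI unfolding blocks_def by blast

lemma blocks_subset: "B \<in> blocks V E \<Longrightarrow> B \<subseteq> V"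
  using hull_subset_vertices unfolding blocks_def by blast

lemma linear_space_blocks:
  assumes "2 \<le> card V" "V \<notin> blocks V E"
  shows "linear_space V (blocks V E)"
proof
  show "l \<subset> V" if "l \<in> blocks V E" for l using that blocks_subset assms(2) by blast
  show "2 \<le> card l" if l: "l \<in> blocks V E" for l
  proof -
    obtain u v where uv: "l = edge_closed E hull {u, v}" "u \<noteq> v"
      using l unfolding blocks_def by blast
    then have "{u, v} \<subseteq> l" using hull_pair_refl by blast
    moreover have "finite l" using l blocks_subset finite_vertices finite_subset by blast
    ultimately have "card {u, v} \<le> card l" by (rule card_mono[rotated])
    then show ?thesis using uv by simp
  qed
  show "\<exists>!l. l \<in> blocks V E \<and> u \<in> l \<and> v \<in> l" if "u \<in> V" "v \<in> V" "u \<noteq> v" for u v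
  proof (rule ex1I[of _ "edge_closed E hull {u, v}"])
    show "edge_closed E hull {u, v} \<in> blocks V E \<and> u \<in> edge_closed E hull {u, v}
        \<and> v \<in> edge_closed E hull {u, v}"
      using that hull_pair_refl unfolding blocks_def by blast
  next
    fix l assume "l \<in> blocks V E \<and> u \<in> l \<and> v \<in> l"
    then show "l = edge_closed E hull {u, v}" using blocks_eqI that(3) by simp
  qed
qed (use assms finite_vertices in auto)

text \<open>A component of the link meeting \<open>A\<close> stays inside \<open>A\<close>, so the
  block through \<open>v\<close> and a vertex of \<open>A\<close> misses \<open>B\<close>.\<close>

lemma not_block_if_link_splits:
  assumes "v \<in> V" "splits (\<lambda>a b. {v, a, b} \<in> E) (V - {v})"
  shows "V \<notin> blocks V E"
proof
  assume V: "V \<in> blocks V E"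
  obtain A B where AB: "A \<noteq> {}" "B \<noteq> {}" "A \<inter> B = {}" "A \<union> B = V - {v}"
    "\<And>a b. a \<in> A \<Longrightarrow> b \<in> B \<Longrightarrow> {v, a, b} \<notin> E"
    by (rule splitsE[OF assms(2)]) (rule that)
  then obtain u where u: "u \<in> A" by blast
  have "w \<in> A" if "(u, w) \<in> (link E v)\<^sup>*" for w
    using that
  proof (induction rule: rtrancl_induct)
    case (step y z)
    then have yz: "{v, y, z} \<in> E" by (simp add: link_def)
    then have "z \<in> A \<union> B" using edgeD[OF yz] AB(4) by blast
    then show ?case using step.IH AB(5) yz by blast
  qed (rule u)
  then have "edge_closed E hull {v, u} \<subseteq> insert v A" by (auto simp: hull_pair)
  moreover have "V = edge_closed E hull {v, u}"
    using V assms(1) u AB(4) by (intro blocks_eqI) auto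
  ultimately show False using AB by blast
qed

text \<open>On the other vertices, the link of \<open>v\<close> in the complementary hypergraph is
  the complement of its link in \<open>E\<close>, and one of these two graphs is disconnected. Three
  vertices are needed for the link to have two.\<close>

lemma block_dichotomy:
  assumes "3 \<le> card V"
  shows "V \<notin> blocks V E \<or> V \<notin> blocks V (nsets V 3 - E)"
proof -
  interpret N: no_two_of_four V "nsets V 3 - E" by (rule complement)
  obtain v where v: "v \<in> V" using assms by fastforce
  let ?g = "\<lambda>a b. {v, a, b} \<in> E"
  have "splits ?g (V - {v}) \<or> splits (\<lambda>a b. \<not> ?g a b) (V - {v})"
  proof (rule P4_free_splits)
    show "P4_free ?g (V - {v})"
      unfolding P4_free_def by (intro ballI impI) (rule link_P4_free)
    show "symp ?g" by (auto simp: symp_def insert_commute)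
    show "2 \<le> card (V - {v})" using v assms finite_vertices by simp
  qed (use finite_vertices in simp)
  then show ?thesis
  proof
    assume co_split: "splits (\<lambda>a b. \<not> ?g a b) (V - {v})"
    obtain A B where AB: "A \<noteq> {}" "B \<noteq> {}" "A \<inter> B = {}" "A \<union> B = V - {v}"
      "\<And>a b. a \<in> A \<Longrightarrow> b \<in> B \<Longrightarrow> \<not> {v, a, b} \<notin> E"
      by (rule splitsE[OF co_split]) (rule that)
    then have "splits (\<lambda>a b. {v, a, b} \<in> nsets V 3 - E) (V - {v})"
      by (intro splitsI[of A B]) auto
    then show ?thesis using N.not_block_if_link_splits v by blast
  qed (use not_block_if_link_splits v in blast)
qed

end

section \<open>Counting lines\<close>

lemma line_subset: "E \<subseteq> nsets V 3 \<Longrightarrow> u \<in> V \<Longrightarrow> v \<in> V \<Longrightarrow> line E u v \<subseteq> V"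
  unfolding line_def by (auto simp: nsets_def)

lemma lines_subset: "E \<subseteq> nsets V 3 \<Longrightarrow> lines V E \<subseteq> Pow V"
proof
  fix l assume E: "E \<subseteq> nsets V 3" and "l \<in> lines V E"
  then obtain u v where "l = line E u v" "u \<in> V" "v \<in> V" unfolding lines_def by blast
  then show "l \<in> Pow V" using line_subset[OF E] by simp
qed

section \<open>Lines compared with blocks of the hypergraph and of its complement\<close>

context no_two_of_four
begin

lemma finite_lines: "finite (lines V E)"
  using finite_subset[OF lines_subset[OF edges]] finite_vertices by simp

lemma hull_image_lines: "(\<lambda>l. edge_closed E hull l) ` lines V E = blocks V E"
proof (intro equalityI subsetI)
  fix B assume "B \<in> (\<lambda>l. edge_closed E hull l) ` lines V E"
  then obtain u v where "u \<in> V" "v \<in> V" "u \<noteq> v" "B = edge_closed E hull line E u v"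
    unfolding lines_def by fast
  then show "B \<in> blocks V E" unfolding blocks_def hull_line by blast
next
  fix B assume "B \<in> blocks V E"
  then obtain u v where "u \<in> V" "v \<in> V" "u \<noteq> v" "B = edge_closed E hull line E u v"
    unfolding blocks_def hull_line by blast
  then show "B \<in> (\<lambda>l. edge_closed E hull l) ` lines V E"
    unfolding lines_def by (intro image_eqI[of _ _ "line E u v"]) auto
qed

lemma card_blocks_le_lines: "card (blocks V E) \<le> card (lines V E)"
  unfolding hull_image_lines[symmetric] using finite_lines by (rule card_image_le)

text \<open>Equal counts make the hull map injective on lines. For \<open>a\<close>,
  \<open>b\<close>, \<open>c\<close> in one block, the lines \<open>a b\<close> and
  \<open>a c\<close> have the same hull and so coincide, which makes \<open>{a, b, c}\<close> a
  hyperedge.\<close>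

lemma edges_eq_if_card_blocks_eq_lines:
  assumes "card (blocks V E) = card (lines V E)"
  shows "E = (\<Union>l\<in>blocks V E. nsets l 3)"
proof
  have inj: "inj_on (\<lambda>l. edge_closed E hull l) (lines V E)"
    using assms finite_lines hull_image_lines by (metis eq_card_imp_inj_on)
  show "E \<subseteq> (\<Union>l\<in>blocks V E. nsets l 3)"
  proof
    fix e assume e: "e \<in> E"
    then obtain a b c where abc: "e = {a, b, c}" "a \<noteq> b" "a \<noteq> c" "b \<noteq> c"
      using edges by (auto simp: nsets_def card_3_iff)
    let ?H = "edge_closed E hull {a, b}"
    have "c \<in> ?H" using edge_closedD[OF edge_closed_hull] hull_pair_refl e abc by metis
    then have "e \<in> nsets ?H 3" using hull_pair_refl abc by (simp add: triple_in_nsets_iff)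
    moreover have "?H \<in> blocks V E" using edgeD e abc unfolding blocks_def by blast
    ultimately show "e \<in> (\<Union>l\<in>blocks V E. nsets l 3)" by blast
  qed
  show "(\<Union>l\<in>blocks V E. nsets l 3) \<subseteq> E"
  proof
    fix e assume "e \<in> (\<Union>l\<in>blocks V E. nsets l 3)"
    then obtain B where B: "B \<in> blocks V E" "e \<subseteq> B" "card e = 3"
      by (auto simp: nsets_def)
    then obtain a b c where abc: "e = {a, b, c}" "a \<noteq> b" "a \<noteq> c" "b \<noteq> c"
      by (auto simp: card_3_iff)
    have V: "a \<in> V" "b \<in> V" "c \<in> V" using B abc blocks_subset by blast+
    have "edge_closed E hull {a, b} = edge_closed E hull {a, c}"
      using blocks_eqI[of B a b] blocks_eqI[of B a c] B abc by simp
    then have "line E a b = line E a c"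
      using inj_onD[OF inj, of "line E a b" "line E a c"] V abc
      by (auto simp: hull_line lines_def)
    then have "c \<in> line E a b" by (simp add: line_def)
    then show "e \<in> E" using abc by (simp add: line_def)
  qed
qed

lemma card_lines_if_no_spanning_block:
  assumes "2 \<le> card V" "V \<notin> blocks V E"
  shows "card V \<le> card (lines V E)"
    and "card (lines V E) = card V \<Longrightarrow> generates_near_pencil V E \<or> generates_projective_plane V E"
proof -
  interpret linear_space V "blocks V E" using assms by (rule linear_space_blocks)
  show "card V \<le> card (lines V E)"
    using card_points_le_blocks card_blocks_le_lines by linarith
  assume eq: "card (lines V E) = card V"
  then have "card (blocks V E) = card V"
    using card_points_le_blocks card_blocks_le_lines by linarith
  then have E: "E = (\<Union>l\<in>blocks V E. nsets l 3)"
    using edges_eq_if_card_blocks_eq_lines eq by simp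
  from near_pencil_or_projective_plane \<open>card (blocks V E) = card V\<close>
  consider w where "w \<in> V" "V - {w} \<in> blocks V E" "\<forall>l\<in>blocks V E. w \<in> l \<longrightarrow> card l = 2"
    | "finite_projective_plane V (blocks V E)" by blast
  then show "generates_near_pencil V E \<or> generates_projective_plane V E"
  proof cases
    case 1
    \<comment> \<open>Blocks through \<open>w\<close> have two points and contribute no triple, so
      all hyperedges avoid \<open>w\<close>.\<close>
    have "nsets l 3 \<subseteq> nsets (V - {w}) 3" if l: "l \<in> blocks V E" for l
    proof (cases "w \<in> l")
      case True
      then have "nsets l 3 = {}" using 1(3) l finite_block by (simp add: nsets_eq_empty)
      then show ?thesis by simp
    next
      case False
      then show ?thesis using blocks_subset[OF l] by (intro nsets_mono) blast
    qed
    then have "E = nsets (V - {w}) 3" using 1(2) by (subst E) blast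
    then show ?thesis using 1(1) unfolding generates_near_pencil_def by blast
  next
    case 2
    then show ?thesis using E unfolding generates_projective_plane_def by blast
  qed
qed

text \<open>A coblock is a block of the complementary hypergraph. A vertex off the line completes
  \<open>u\<close> and \<open>v\<close> to a triple of that hypergraph, hence lies in their
  coblock.\<close>

lemma complement_subset_coblock:
  assumes B: "B \<in> blocks V (nsets V 3 - E)" "u \<in> B" "v \<in> B" "u \<noteq> v"
  shows "V - line E u v \<subseteq> B"
proof
  interpret N: no_two_of_four V "nsets V 3 - E" by (rule complement)
  fix w assume w: "w \<in> V - line E u v"
  have "u \<in> V" "v \<in> V" using B N.blocks_subset by blast+
  then have "{u, v, w} \<in> nsets V 3 - E"
    using w \<open>u \<noteq> v\<close> by (auto simp: line_def triple_in_nsets_iff)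
  then show "w \<in> B"
    using N.blocks_eqI[OF B] edge_closedD[OF edge_closed_hull] B by metis
qed

text \<open>Since the complement of such a line lies in \<open>B\<close>, it equals the complement
  within \<open>B\<close> of the line of the induced hypergraph, and complementation is
  injective.\<close>

lemma card_complements_in_coblock:
  assumes "B \<in> blocks V (nsets V 3 - E)"
  shows "card {V - line E u v | u v. u \<in> B \<and> v \<in> B \<and> u \<noteq> v} = card (lines B (E \<inter> nsets B 3))"
proof -
  interpret N: no_two_of_four V "nsets V 3 - E" by (rule complement)
  have B: "B \<subseteq> V" using assms by (rule N.blocks_subset)
  have "V - line E u v = B - line (E \<inter> nsets B 3) u v" if "u \<in> B" "v \<in> B" "u \<noteq> v" for u v
    using complement_subset_coblock[OF assms that] that B
    by (auto simp: line_def triple_in_nsets_iff)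
  then have "{V - line E u v | u v. u \<in> B \<and> v \<in> B \<and> u \<noteq> v} = (\<lambda>l. B - l) ` lines B (E \<inter> nsets B 3)"
    unfolding lines_def by (auto; metis)
  moreover have "inj_on (\<lambda>l. B - l) (lines B (E \<inter> nsets B 3))"
    using lines_subset[of "E \<inter> nsets B 3" B] by (intro inj_onI) blast
  ultimately show ?thesis by (simp add: card_image)
qed

text \<open>Passes the hypothesis on spanning lines down to coblocks, as the induction
  requires.\<close>

lemma coblock_not_line:
  assumes "V \<notin> lines V E" and B: "B \<in> blocks V (nsets V 3 - E)"
  shows "B \<notin> lines B (E \<inter> nsets B 3)"
proof
  interpret N: no_two_of_four V "nsets V 3 - E" by (rule complement)
  assume "B \<in> lines B (E \<inter> nsets B 3)"
  then obtain u v where uv: "u \<in> B" "v \<in> B" "u \<noteq> v" "B = line (E \<inter> nsets B 3) u v"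
    unfolding lines_def by blast
  then have "B \<subseteq> line E u v" unfolding line_def by blast
  then have "V \<subseteq> line E u v" using complement_subset_coblock[OF B uv(1-3)] by blast
  moreover have "u \<in> V" "v \<in> V" using uv N.blocks_subset[OF B] by blast+
  ultimately have "V \<in> lines V E"
    using line_subset[OF edges, of u v] uv(3) unfolding lines_def by blast
  then show False using assms(1) by simp
qed

text \<open>The complements of the lines spanned by pairs inside a block of the complementary
  hypergraph stay inside that block. A complement with at least two points therefore
  determines its block, and each point whose singleton is no such complement lies in
  at least two blocks that have to make up for it.\<close>

lemma card_lines_if_no_spanning_coblock:
  defines "N \<equiv> nsets V 3 - E"
  assumes V2: "2 \<le> card V" and no_block: "V \<notin> blocks V N" and no_line: "V \<notin> lines V E"
    and sub: "\<And>B. B \<in> blocks V N \<Longrightarrow> card B \<le> card (lines B (E \<inter> nsets B 3))"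
  shows "card V \<le> card (lines V E)"
    and "card (lines V E) = card V \<Longrightarrow> u \<in> V \<Longrightarrow> v \<in> V \<Longrightarrow> u \<noteq> v \<Longrightarrow> \<exists>w. V - line E u v = {w}"
proof -
  interpret N: no_two_of_four V N unfolding N_def by (rule complement)
  interpret N: linear_space V "blocks V N" using V2 no_block by (rule N.linear_space_blocks)
  define c where "c u v = V - line E u v" for u v
  define CC where "CC B = {c u v | u v. u \<in> B \<and> v \<in> B \<and> u \<noteq> v}" for B
  define S where "S = {w \<in> V. {w} \<in> CC V}"
  define D where "D B = {X \<in> CC B. \<not> is_singleton X}" for B
  have c_nonempty: "c u v \<noteq> {}" if "u \<in> V" "v \<in> V" "u \<noteq> v" for u v
    using line_subset[OF edges that(1,2)] no_line that unfolding c_def lines_def by blast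
  have c_sub: "c u v \<subseteq> B" if "B \<in> blocks V N" "u \<in> B" "v \<in> B" "u \<noteq> v" for u v B
    using complement_subset_coblock that unfolding c_def N_def by blast
  have "lines V E \<subseteq> Pow V" by (rule lines_subset[OF edges])
  then have "inj_on (\<lambda>l. V - l) (lines V E)" by (intro inj_onI) blast
  moreover have "(\<lambda>l. V - l) ` lines V E = CC V"
    unfolding CC_def c_def lines_def by blast
  ultimately have card_CC: "card (CC V) = card (lines V E)" by (metis card_image)
  have CC_mono: "CC B \<subseteq> CC V" if "B \<in> blocks V N" for B
    using N.blocks_subset[OF that] unfolding CC_def by blast
  have "CC V \<subseteq> Pow V" unfolding CC_def c_def by blast
  then have fin_CC: "finite (CC V)" using finite_vertices finite_subset by blast
  have CC_sub: "X \<subseteq> B" if B: "B \<in> blocks V N" and X: "X \<in> CC B" for X B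
  proof -
    obtain u v where "X = c u v" "u \<in> B" "v \<in> B" "u \<noteq> v" using X unfolding CC_def by blast
    then show ?thesis using c_sub[OF B] by simp
  qed
  have CC_nonempty: "X \<noteq> {}" if X: "X \<in> CC V" for X
  proof -
    obtain u v where "X = c u v" "u \<in> V" "v \<in> V" "u \<noteq> v" using X unfolding CC_def by blast
    then show ?thesis using c_nonempty by simp
  qed
  have fin_D: "finite (D B)" if "B \<in> blocks V N" for B
    using finite_subset[OF CC_mono[OF that] fin_CC] unfolding D_def by simp
  have card_D: "card (B - S) \<le> card (D B)" if B: "B \<in> blocks V N" for B
  proof -
    \<comment> \<open>By \<open>sub\<close>, \<open>CC B\<close> has at least \<open>card B\<close>
      members; its singletons come from points of \<open>B \<inter> S\<close>, so the rest of the
      count falls on \<open>D B\<close>.\<close>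
    have "CC B \<subseteq> D B \<union> (\<lambda>w. {w}) ` (B \<inter> S)"
    proof
      fix X assume X: "X \<in> CC B"
      show "X \<in> D B \<union> (\<lambda>w. {w}) ` (B \<inter> S)"
      proof (cases "is_singleton X")
        case True
        then obtain w where w: "X = {w}" by (rule is_singletonE)
        then have "w \<in> B" using X CC_sub[OF B] by blast
        moreover have "w \<in> S"
          using \<open>w \<in> B\<close> N.blocks_subset[OF B] CC_mono[OF B] X w unfolding S_def by blast
        ultimately show ?thesis using w by blast
      qed (use X D_def in simp)
    qed
    then have "card (CC B) \<le> card (D B \<union> (\<lambda>w. {w}) ` (B \<inter> S))"
      using fin_D[OF B] N.finite_block[OF B] by (intro card_mono) auto
    also have "\<dots> \<le> card (D B) + card ((\<lambda>w. {w}) ` (B \<inter> S))" by (rule card_Un_le)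
    also have "\<dots> = card (D B) + card (B \<inter> S)" by (simp add: card_image)
    finally have "card B \<le> card (D B) + card (B \<inter> S)"
      using sub[OF B] card_complements_in_coblock B unfolding CC_def c_def N_def by simp
    moreover have "card B = card (B \<inter> S) + card (B - S)"
      using N.finite_block[OF B] by (metis card_Int_Diff)
    ultimately show ?thesis by simp
  qed
  have D_disjoint: "D B \<inter> D B' = {}" if B: "B \<in> blocks V N" "B' \<in> blocks V N" "B \<noteq> B'" for B B'
  proof (rule ccontr)
    assume "D B \<inter> D B' \<noteq> {}"
    then obtain X where X: "X \<in> CC B" "X \<in> CC B'" "\<not> is_singleton X" by (auto simp: D_def)
    have "X \<subseteq> B" "X \<subseteq> B'" using X(1,2) CC_sub B(1,2) by blast+
    moreover have "X \<noteq> {}"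
      using X(1) CC_mono[OF B(1)] CC_nonempty by blast
    then obtain x where "x \<in> X" by blast
    moreover have "X \<noteq> {x}" using X(3) by (auto simp: is_singleton_def)
    ultimately show False using N.block_eqI[OF B(1,2)] B(3) by blast
  qed
  have "2 * card (V - S) = (\<Sum>x\<in>V - S. 2)" by simp
  also have "\<dots> \<le> (\<Sum>x\<in>V - S. \<Sum>B\<in>{B \<in> blocks V N. x \<in> B}. 1)"
    using N.two_le_deg by (intro sum_mono) simp
  also have "\<dots> = (\<Sum>B\<in>blocks V N. \<Sum>x\<in>{x \<in> V - S. x \<in> B}. 1)"
    using finite_vertices N.finite_blocks by (intro sum.swap_restrict) auto
  also have "\<dots> = (\<Sum>B\<in>blocks V N. card (B - S))"
  proof (rule sum.cong[OF refl])
    fix B assume "B \<in> blocks V N"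
    then have "{x \<in> V - S. x \<in> B} = B - S" using N.blocks_subset by blast
    then show "(\<Sum>x\<in>{x \<in> V - S. x \<in> B}. 1) = card (B - S)" by simp
  qed
  also have "\<dots> \<le> (\<Sum>B\<in>blocks V N. card (D B))"
    using card_D by (intro sum_mono)
  also have "\<dots> = card (\<Union>B\<in>blocks V N. D B)"
    using N.finite_blocks fin_D D_disjoint by (intro card_UN_disjoint[symmetric]) auto
  finally have many_D: "2 * card (V - S) \<le> card (\<Union>B\<in>blocks V N. D B)" .
  have "card S + card (\<Union>B\<in>blocks V N. D B) = card ((\<lambda>w. {w}) ` S \<union> (\<Union>B\<in>blocks V N. D B))"
    using N.finite_blocks fin_D finite_vertices
    by (subst card_Un_disjoint) (auto simp: card_image D_def S_def)
  also have "\<dots> \<le> card (CC V)"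
    using CC_mono fin_CC by (intro card_mono) (auto simp: D_def S_def)
  finally have total: "card S + card (\<Union>B\<in>blocks V N. D B) \<le> card (lines V E)"
    unfolding card_CC .
  have S: "S \<subseteq> V" "finite S" unfolding S_def using finite_vertices by auto
  then have card_V: "card V = card S + card (V - S)"
    using finite_vertices by (metis card_Int_Diff inf.absorb2)
  show "card V \<le> card (lines V E)" using total many_D card_V by linarith
  assume eq: "card (lines V E) = card V" and uv: "u \<in> V" "v \<in> V" "u \<noteq> v"
  \<comment> \<open>Points outside \<open>S\<close> are counted at least twice, so equality leaves
    none; the singletons then exhaust \<open>CC V\<close>.\<close>
  have "card (V - S) = 0" using total many_D card_V eq by linarith
  then have "S = V" using S finite_vertices by auto
  have "(\<lambda>w. {w}) ` V = CC V"
  proof (rule card_subset_eq[OF fin_CC])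
    show "(\<lambda>w. {w}) ` V \<subseteq> CC V" using \<open>S = V\<close> S_def by blast
    show "card ((\<lambda>w. {w}) ` V) = card (CC V)" using card_CC eq by (simp add: card_image)
  qed
  moreover have "c u v \<in> CC V" using uv unfolding CC_def by blast
  ultimately show "\<exists>w. V - line E u v = {w}" unfolding c_def by blast
qed

lemma three_le_card:
  assumes "2 \<le> card V" "V \<notin> lines V E"
  shows "3 \<le> card V"
proof (rule ccontr)
  assume "\<not> ?thesis"
  then have "card V = 2" using assms(1) by simp
  then obtain u v where "V = {u, v}" "u \<noteq> v" by (auto simp: card_2_iff)
  then have "line E u v \<in> lines V E" "{u, v} \<subseteq> line E u v" "line E u v \<subseteq> V"
    using line_subset[OF edges, of u v] by (auto simp: lines_def line_def)
  then have "line E u v = V" using \<open>V = {u, v}\<close> by blast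
  then show False using assms(2) \<open>line E u v \<in> lines V E\<close> by simp
qed

end

text \<open>Strong induction on the number of vertices. If \<open>V\<close> is a block, it is not a
  coblock, and the induction hypothesis applies to the hypergraphs induced on the coblocks, which
  are smaller.\<close>

lemma card_vertices_le_lines:
  assumes "no_two_of_four V E" "2 \<le> card V" "V \<notin> lines V E"
  shows "card V \<le> card (lines V E)"
  using assms
proof (induction "card V" arbitrary: V E rule: less_induct)
  case less
  interpret no_two_of_four V E by (rule less.prems(1))
  let ?N = "nsets V 3 - E"
  show ?case
  proof (cases "V \<in> blocks V E")
    case False
    then show ?thesis using card_lines_if_no_spanning_block less.prems(2) by blast
  next
    case True
    then have no_block: "V \<notin> blocks V ?N"
      using block_dichotomy three_le_card less.prems(2,3) by blast
    interpret N: no_two_of_four V ?N by (rule complement)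
    interpret N: linear_space V "blocks V ?N"
      using less.prems(2) no_block by (rule N.linear_space_blocks)
    show ?thesis
    proof (rule card_lines_if_no_spanning_coblock(1)[OF less.prems(2) no_block less.prems(3)])
      fix B assume B: "B \<in> blocks V ?N"
      show "card B \<le> card (lines B (E \<inter> nsets B 3))"
      proof (rule less.hyps)
        show "card B < card V"
          using psubset_card_mono[OF finite_vertices N.block_psubset[OF B]] .
        show "no_two_of_four B (E \<inter> nsets B 3)" using restrict N.blocks_subset[OF B] .
        show "2 \<le> card B" using B by (rule N.block_card)
        show "B \<notin> lines B (E \<inter> nsets B 3)" using less.prems(3) B by (rule coblock_not_line)
      qed
    qed
  qed
qed

text \<open>Supplies the assumption \<open>sub\<close> of
  \<open>card_lines_if_no_spanning_coblock\<close> for the equality case, now that the bound is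
  known.\<close>

lemma (in no_two_of_four) card_coblock_le_lines:
  assumes "2 \<le> card V" "V \<notin> blocks V (nsets V 3 - E)" "V \<notin> lines V E"
    and B: "B \<in> blocks V (nsets V 3 - E)"
  shows "card B \<le> card (lines B (E \<inter> nsets B 3))"
proof -
  interpret N: no_two_of_four V "nsets V 3 - E" by (rule complement)
  interpret N: linear_space V "blocks V (nsets V 3 - E)"
    using assms(1,2) by (rule N.linear_space_blocks)
  show ?thesis
    using card_vertices_le_lines restrict[OF N.blocks_subset[OF B]] N.block_card[OF B]
      coblock_not_line[OF assms(3) B] by blast
qed

lemma (in no_two_of_four) steiner_complement_if_complements_singletons:
  assumes "\<And>u v. u \<in> V \<Longrightarrow> v \<in> V \<Longrightarrow> u \<noteq> v \<Longrightarrow> \<exists>w. V - line E u v = {w}"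
  shows "complement_of_steiner_triple_system V E"
  unfolding complement_of_steiner_triple_system_def
proof (intro ballI impI)
  fix u v assume uv: "u \<in> V" "v \<in> V" "u \<noteq> v"
  then obtain w where w: "V - line E u v = {w}" using assms by blast
  have nonedge: "{u, v, z} \<in> nsets V 3 - E \<longleftrightarrow> z = w" for z
  proof -
    have "{u, v, z} \<in> nsets V 3 - E \<longleftrightarrow> z \<in> V - line E u v"
      using uv by (auto simp: line_def triple_in_nsets_iff)
    then show ?thesis using w by simp
  qed
  show "\<exists>!t. t \<in> nsets V 3 - E \<and> u \<in> t \<and> v \<in> t"
  proof (rule ex1I[of _ "{u, v, w}"])
    fix t assume t: "t \<in> nsets V 3 - E \<and> u \<in> t \<and> v \<in> t"
    then have "card (t - {u, v}) = 1"
      using uv(3) by (subst card_Diff_subset) (auto simp: nsets_def)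
    then obtain z where "t - {u, v} = {z}" by (rule card_1_singletonE)
    then have "t = {u, v, z}" using t by blast
    then show "t = {u, v, w}" using t nonedge[of z] by simp
  qed (use nonedge[of w] in blast)
qed

lemma (in no_two_of_four) extremal_cases:
  assumes "2 \<le> card V" "V \<notin> lines V E" "card (lines V E) = card V"
  shows "generates_near_pencil V E \<or> generates_projective_plane V E \<or>
    complement_of_steiner_triple_system V E"
proof (cases "V \<in> blocks V E")
  case False
  then show ?thesis using card_lines_if_no_spanning_block(2) assms by blast
next
  case True
  then have no_block: "V \<notin> blocks V (nsets V 3 - E)"
    using block_dichotomy three_le_card assms(1,2) by blast
  have "\<exists>w. V - line E u v = {w}" if "u \<in> V" "v \<in> V" "u \<noteq> v" for u v
    using card_lines_if_no_spanning_coblock(2)[OF assms(1) no_block assms(2)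
        card_coblock_le_lines assms(3) that] assms(1,2) no_block by blast
  then show ?thesis using steiner_complement_if_complements_singletons by blast
qed

section \<open>The extremal hypergraphs\<close>

lemma card_lines_near_pencil:
  assumes "finite V" "3 \<le> card V" "generates_near_pencil V E"
  shows "card (lines V E) = card V"
proof -
  obtain w where w: "w \<in> V" "E = nsets (V - {w}) 3"
    using assms(3) unfolding generates_near_pencil_def by blast
  let ?W = "V - {w}"
  have W2: "2 \<le> card ?W" using assms w by simp
  have long: "line E u v = ?W" if "u \<in> ?W" "v \<in> ?W" "u \<noteq> v" for u v
    using that by (auto simp: line_def w(2) triple_in_nsets_iff)
  have short: "line E u w = {u, w}" "line E w u = {u, w}" for u
    by (auto simp: line_def w(2) triple_in_nsets_iff)
  have "lines V E = insert ?W ((\<lambda>u. {u, w}) ` ?W)"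
  proof (intro equalityI subsetI)
    fix l assume "l \<in> lines V E"
    then obtain u v where uv: "u \<in> V" "v \<in> V" "u \<noteq> v" "l = line E u v"
      unfolding lines_def by blast
    then show "l \<in> insert ?W ((\<lambda>u. {u, w}) ` ?W)"
      using long[of u v] short[of u] short[of v] by (cases "u = w"; cases "v = w") auto
  next
    fix l assume "l \<in> insert ?W ((\<lambda>u. {u, w}) ` ?W)"
    then consider "l = ?W" | u where "u \<in> ?W" "l = line E u w" using short by auto
    then show "l \<in> lines V E"
    proof cases
      case 1
      obtain T where "T \<subseteq> ?W" "card T = 2" using obtain_subset_with_card_n[OF W2] by blast
      then obtain u v where "u \<in> ?W" "v \<in> ?W" "u \<noteq> v" by (auto simp: card_2_iff)
      then show ?thesis using long[of u v] 1 unfolding lines_def by blast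
    next
      case 2
      then show ?thesis using w(1) unfolding lines_def by blast
    qed
  qed
  \<comment> \<open>The long line avoids \<open>w\<close> and the short ones contain it, so there
    are \<open>1 + (card V - 1)\<close> lines.\<close>
  moreover have "?W \<notin> (\<lambda>u. {u, w}) ` ?W" by blast
  moreover have "inj_on (\<lambda>u. {u, w}) ?W" by (intro inj_onI) (auto simp: doubleton_eq_iff)
  ultimately have "card (lines V E) = Suc (card ?W)"
    using assms(1) by (simp add: card_image)
  then show ?thesis using w(1) assms(1,2) by simp
qed

text \<open>The lines are exactly the members of \<open>L\<close>. Counting vertex pairs by the
  member containing them gives \<open>card V choose 2 = card L * (k choose 2)\<close>, and
  \<open>card V - 1 = k * (k - 1)\<close> then cancels.\<close>

lemma card_lines_projective_plane:
  assumes "2 \<le> card V" "generates_projective_plane V E"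
  shows "card (lines V E) = card V"
proof -
  obtain L where plane: "finite_projective_plane V L" and E: "E = (\<Union>l\<in>L. nsets l 3)"
    using assms(2) unfolding generates_projective_plane_def by blast
  have fin: "finite V" and L_sub: "L \<subseteq> Pow V"
    using plane unfolding finite_projective_plane_def hypergraph_def by simp_all
  obtain k where k: "2 \<le> k" "card V = k * (k - 1) + 1" and size: "\<forall>l\<in>L. card l = k"
    and ex1: "\<forall>u\<in>V. \<forall>v\<in>V. u \<noteq> v \<longrightarrow> (\<exists>!l. l \<in> L \<and> u \<in> l \<and> v \<in> l)"
    using plane unfolding finite_projective_plane_def by (elim conjE exE) (rule that)
  have join: "\<exists>!l. l \<in> L \<and> u \<in> l \<and> v \<in> l" if "u \<in> V" "v \<in> V" "u \<noteq> v" for u v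
    using ex1 that by simp
  have line: "line E u v = l" if l: "l \<in> L" "u \<in> l" "v \<in> l" "u \<noteq> v" for u v l
  proof -
    have "u \<in> V" "v \<in> V" using l L_sub by blast+
    then have unique: "m = l" if "m \<in> L" "u \<in> m" "v \<in> m" for m
      using join[of u v] l that by blast
    have "{u, v, w} \<in> E \<longleftrightarrow> w \<in> l \<and> w \<noteq> u \<and> w \<noteq> v" for w
    proof
      assume "{u, v, w} \<in> E"
      then obtain m where "m \<in> L" "{u, v, w} \<in> nsets m 3" unfolding E by blast
      then show "w \<in> l \<and> w \<noteq> u \<and> w \<noteq> v"
        using unique[of m] by (auto simp: triple_in_nsets_iff)
    next
      assume "w \<in> l \<and> w \<noteq> u \<and> w \<noteq> v"
      then have "{u, v, w} \<in> nsets l 3" using l by (auto simp: triple_in_nsets_iff)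
      then show "{u, v, w} \<in> E" using l(1) unfolding E by blast
    qed
    then have "line E u v = {u, v} \<union> (l - {u, v})" unfolding line_def by auto
    also have "\<dots> = l" using l by blast
    finally show ?thesis .
  qed
  have "lines V E = L"
  proof (intro equalityI subsetI)
    fix l assume "l \<in> lines V E"
    then obtain u v where uv: "u \<in> V" "v \<in> V" "u \<noteq> v" "l = line E u v"
      unfolding lines_def by blast
    then obtain m where "m \<in> L" "u \<in> m" "v \<in> m" using join[of u v] by blast
    then show "l \<in> L" using line[of m u v] uv by simp
  next
    fix l assume l: "l \<in> L"
    obtain T where "T \<subseteq> l" "card T = 2"
      using obtain_subset_with_card_n[of 2 l] size l k(1) by metis
    then obtain u v where uv: "u \<in> l" "v \<in> l" "u \<noteq> v" by (auto simp: card_2_iff)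
    then have "u \<in> V" "v \<in> V" using l L_sub by blast+
    then show "l \<in> lines V E" using line[OF l uv] uv(3) unfolding lines_def by blast
  qed
  have finL: "finite L" using finite_subset[OF L_sub] fin by simp
  have fin_l: "finite l" if "l \<in> L" for l using that L_sub fin finite_subset by blast
  have pairs: "nsets V 2 = (\<Union>l\<in>L. nsets l 2)"
  proof (intro equalityI subsetI)
    fix p assume "p \<in> nsets V 2"
    then obtain u v where uv: "p = {u, v}" "u \<noteq> v" "u \<in> V" "v \<in> V" by (rule nsets2_E) auto
    then obtain l where "l \<in> L" "u \<in> l" "v \<in> l" using join[of u v] by blast
    then show "p \<in> (\<Union>l\<in>L. nsets l 2)" using uv by auto
  next
    fix p assume "p \<in> (\<Union>l\<in>L. nsets l 2)"
    then obtain l where "l \<in> L" "p \<in> nsets l 2" by blast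
    then show "p \<in> nsets V 2" using L_sub nsets_mono[of l V 2] by blast
  qed
  have disjoint: "nsets l 2 \<inter> nsets m 2 = {}" if lm: "l \<in> L" "m \<in> L" "l \<noteq> m" for l m
  proof (rule ccontr)
    assume "nsets l 2 \<inter> nsets m 2 \<noteq> {}"
    then obtain p where p: "p \<in> nsets l 2" "p \<in> nsets m 2" by blast
    from p(1) obtain u v where uv: "p = {u, v}" "u \<noteq> v" by (rule nsets2_E) auto
    then have "u \<in> l" "v \<in> l" "u \<in> m" "v \<in> m" using p by auto
    then show False using line[OF lm(1)] line[OF lm(2)] uv(2) lm(3) by metis
  qed
  have card_pairs: "card (nsets A 2) = card A choose 2" if "finite A" for A :: "'a set"
    using n_subsets[OF that, of 2] finite_subset[OF _ that] by (simp add: nsets_def cong: conj_cong)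
  have "card V choose 2 = (\<Sum>l\<in>L. card (nsets l 2))"
    unfolding card_pairs[OF fin, symmetric] pairs
    using finL disjoint fin_l by (intro card_UN_disjoint) (simp_all add: finite_imp_finite_nsets)
  also have "\<dots> = card L * (k choose 2)" using fin_l size by (simp add: card_pairs)
  finally have "2 * (card V choose 2) = card L * (2 * (k choose 2))" by simp
  moreover have "2 * (n choose 2) = n * (n - 1)" for n :: nat
  proof -
    have "even (n * (n - 1))" by (cases n) auto
    then show ?thesis unfolding choose_two by (rule dvd_mult_div_cancel)
  qed
  ultimately have "card V * (card V - 1) = card L * (k * (k - 1))" by simp
  then have "card V * (k * (k - 1)) = card L * (k * (k - 1))" using k(2) by simp
  then have "card L = card V" using k(1) by simp
  then show ?thesis using \<open>lines V E = L\<close> by simp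
qed

text \<open>The line through \<open>u\<close> and \<open>v\<close> misses only the third point of
  their Steiner triple. Conversely, any point \<open>w\<close> is missed by the line through the
  other two points of a triple containing \<open>w\<close>.\<close>

lemma card_lines_steiner_complement:
  assumes "E \<subseteq> nsets V 3" "2 \<le> card V" "complement_of_steiner_triple_system V E"
  shows "card (lines V E) = card V"
proof -
  have third: "\<exists>w\<in>V. u \<noteq> w \<and> v \<noteq> w \<and> {u, v, w} \<notin> E \<and> line E u v = V - {w}"
    if uv: "u \<in> V" "v \<in> V" "u \<noteq> v" for u v
  proof -
    have ex1: "\<exists>!t. t \<in> nsets V 3 - E \<and> u \<in> t \<and> v \<in> t"
      using assms(3) uv unfolding complement_of_steiner_triple_system_def by blast
    then obtain t where t: "t \<in> nsets V 3 - E" "u \<in> t" "v \<in> t" by blast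
    then have "card (t - {u, v}) = 1"
      using uv(3) by (subst card_Diff_subset) (auto simp: nsets_def)
    then obtain w where "t - {u, v} = {w}" by (rule card_1_singletonE)
    then have tw: "t = {u, v, w}" using t by blast
    then have w: "w \<in> V" "u \<noteq> w" "v \<noteq> w" "{u, v, w} \<notin> E"
      using t(1) by (auto simp: triple_in_nsets_iff)
    have "{u, v, z} \<in> E" if "z \<in> V" "z \<noteq> u" "z \<noteq> v" "z \<noteq> w" for z
    proof (rule ccontr)
      assume "{u, v, z} \<notin> E"
      then have "{u, v, z} \<in> nsets V 3 - E"
        using that uv by (auto simp: triple_in_nsets_iff)
      then have "{u, v, z} = {u, v, w}" using ex1 t tw by blast
      then show False using that by auto
    qed
    then have "line E u v = V - {w}"
      using line_subset[OF assms(1) uv(1,2)] w uv by (auto simp: line_def)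
    then show ?thesis using w by blast
  qed
  have "lines V E = (\<lambda>w. V - {w}) ` V"
  proof (intro equalityI subsetI)
    fix l assume "l \<in> lines V E"
    then obtain u v where uv: "u \<in> V" "v \<in> V" "u \<noteq> v" "l = line E u v"
      unfolding lines_def by blast
    then show "l \<in> (\<lambda>w. V - {w}) ` V" using third[OF uv(1-3)] by blast
  next
    fix l assume "l \<in> (\<lambda>w. V - {w}) ` V"
    then obtain w where w: "w \<in> V" "l = V - {w}" by blast
    have "\<not> V \<subseteq> {w}" using assms(2) card_mono[of "{w}" V] by auto
    then obtain u where u: "u \<in> V" "u \<noteq> w" by blast
    then obtain v where v: "v \<in> V" "u \<noteq> v" "w \<noteq> v" "{u, w, v} \<notin> E"
      using third[of u w] w(1) by blast
    obtain z where z: "line E u v = V - {z}" using third[of u v] u v by blast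
    have "w \<notin> line E u v" using v u by (auto simp: line_def insert_commute)
    then have "z = w" using z w(1) by blast
    then show "l \<in> lines V E" using z w(2) u(1) v(1,2) unfolding lines_def by blast
  qed
  moreover have "inj_on (\<lambda>w. V - {w}) V" by (intro inj_onI) blast
  ultimately show ?thesis by (simp add: card_image)
qed

section \<open>From induced hyperedge counts to \<open>third_edge\<close>\<close>

lemma no_two_of_fourI:
  assumes "hypergraph V E" "three_uniform E" "finite V" "\<not> four_vertices_induce_two V E"
  shows "no_two_of_four V E"
proof
  show "finite V" by fact
  show E: "E \<subseteq> nsets V 3"
    using assms(1-3) finite_subset unfolding hypergraph_def three_uniform_def nsets_def by blast
  fix a b c d assume abc: "{a, b, c} \<in> E" and abd: "{a, b, d} \<in> E" and "c \<noteq> d"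
  have dist: "distinct [a, b, c, d]" and V: "{a, b, c, d} \<subseteq> V"
    using abc abd E \<open>c \<noteq> d\<close> triple_in_nsets_iff[of a b c V] triple_in_nsets_iff[of a b d V]
    by auto
  show "{a, c, d} \<in> E \<or> {b, c, d} \<in> E"
  proof (rule ccontr)
    assume non: "\<not> ?thesis"
    have "induced_edges E {a, b, c, d} = {{a, b, c}, {a, b, d}}"
    proof (intro equalityI subsetI)
      fix e assume "e \<in> induced_edges E {a, b, c, d}"
      then have e: "e \<in> E" "e \<subseteq> {a, b, c, d}" unfolding induced_edges_def by auto
      then have "card e = 3" using assms(2) unfolding three_uniform_def by blast
      \<comment> \<open>A triple among four vertices is named by the vertex it omits, leaving four
        candidates for \<open>e\<close>.\<close>
      then have "card ({a, b, c, d} - e) = 1"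
        using e(2) dist by (subst card_Diff_subset) (auto intro: finite_subset)
      then obtain x where x: "{a, b, c, d} - e = {x}" by (rule card_1_singletonE)
      then have "e = {a, b, c, d} - {x}" using e(2) by blast
      moreover have "x \<in> {a, b, c, d}" using x by blast
      ultimately have "e = {b, c, d} \<or> e = {a, c, d} \<or> e = {a, b, d} \<or> e = {a, b, c}"
        using dist by auto
      then show "e \<in> {{a, b, c}, {a, b, d}}" using e(1) non by auto
    qed (use abc abd in \<open>auto simp: induced_edges_def\<close>)
    moreover have "{a, b, c} \<noteq> {a, b, d}" using dist by auto
    ultimately have "card (induced_edges E {a, b, c, d}) = 2" by simp
    moreover have "card {a, b, c, d} = 4" using dist by simp
    ultimately show False using assms(4) V unfolding four_vertices_induce_two_def by blast
  qed
qed

theorem theorem2: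
  fixes V :: "'a set" and E :: "'a set set"
  assumes "hypergraph V E"
    and "three_uniform E"
    and "finite V"
    and "card V \<ge> 2"
    and "\<not> four_vertices_induce_two V E"
    and "V \<notin> lines V E"
  shows "card (lines V E) \<ge> card V \<and>
    (card (lines V E) = card V \<longleftrightarrow>
       generates_near_pencil V E \<or>
       generates_projective_plane V E \<or>
       complement_of_steiner_triple_system V E)"
proof -
  interpret no_two_of_four V E using assms(1-3,5) by (rule no_two_of_fourI)
  show ?thesis
    using card_vertices_le_lines[OF no_two_of_four_axioms assms(4,6)] extremal_cases[OF assms(4,6)]
      card_lines_near_pencil[OF assms(3) three_le_card[OF assms(4,6)]]
      card_lines_projective_plane[OF assms(4)]
      card_lines_steiner_complement[OF edges assms(4)]
    by blast
qed

end
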